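(* Let $p\ge 5$ be a prime and let $a$ be a positive integer such that $\gcd(a,p)=1$. Let $k\ge 3$ be an odd integer such that there exists a positive integer $n_1$ with $n_1>3\log_p(k-1)+\log_p a$ and $v_p\big(s(ap^{n_1},ap^{n_1}-(k-1))\big)<n_1$. Then for any integer $n\ge n_1$, $$v_p(s(ap^{n+1},ap^{n+1}-k))=v_p(s(ap^n,ap^n-k))+2.$$ Furthermore, $v_p(s(ap^{n},ap^{n}-k))=v_p(s(ap^{n_1},ap^{n_1}-k))+2(n-n_1)$ for all $n\ge n_1$.
   Context: For nonnegative integers $n,k$, the (unsigned) Stirling numbers of the first kind $s(n,k)$ are defined by $x(x+1)\cdots(x+n-1)=\sum_{k=0}^n s(n,k)x^k$. $v_p$ denotes the $p$-adic valuation. *)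

theory Defs
  imports
    Complex_Main
    "HOL-Combinatorics.Stirling"
    "HOL-Computational_Algebra.Factorial_Ring"
    "HOL-Computational_Algebra.Primes"
begin

text \<open>
  The unsigned Stirling number of the first kind $s(n,k)$ is the library constant
  \<^const>\<open>stirling\<close>; its characterisation by the rising factorial is
  \<open>stirling_pochhammer\<close> in that theory.  The $p$-adic valuation is
  \<^const>\<open>multiplicity\<close>.  Since \<open>multiplicity p 0 = 0\<close>, and since subtraction on
  \<^typ>\<open>nat\<close> truncates, it matters that every Stirling number whose valuation is taken
  is nonzero and has an untruncated second argument.  The next two facts give this: the bound
  on \<open>n\<^sub>1\<close> below implies \<open>k < a * p ^ n\<close> for all \<open>n \<ge> n\<^sub>1\<close>.
\<close>

lemma stirling_diff_pos:
  fixes m j :: nat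
  assumes "j < m"
  shows "0 < stirling m (m - j)"
proof -
  have "0 < stirling m i" if "0 < i" "i \<le> m" for i
    using that
  proof (induction m arbitrary: i)
    case 0
    then show ?case by simp
  next
    case (Suc m)
    then obtain i' where i: "i = Suc i'" by (cases i) auto
    show ?case
    proof (cases "i' = m")
      case True
      then show ?thesis by (simp add: i)
    next
      case False
      then have "0 < stirling m (Suc i')" "0 < m" using Suc i by auto
      then show ?thesis by (simp add: i)
    qed
  qed
  then show ?thesis using assms by simp
qed

lemma index_in_range:
  fixes p a k n1 n :: nat
  assumes "prime p" "0 < a" "3 \<le> k"
    and bound: "real n1 > 3 * log (real p) (real k - 1) + log (real p) (real a)"
    and "n1 \<le> n"
  shows "k < a * p ^ n"
proof -
  have p: "1 < real p" using prime_gt_1_nat[OF assms(1)] by simp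
  have k: "2 \<le> real k - 1" using assms(3) by linarith
  have "0 \<le> log (real p) (real a)" using p assms(2) by (simp add: zero_le_log_cancel_iff)
  moreover have "log (real p) ((real k - 1) ^ 3) = 3 * log (real p) (real k - 1)"
    using k by (simp add: log_nat_power)
  ultimately have "log (real p) ((real k - 1) ^ 3) < real n" using bound assms(5) by linarith
  then have "(real k - 1) ^ 3 < real p powr real n"
    using p k by (subst (asm) log_less_iff) auto
  then have A: "(real k - 1) ^ 3 < real (p ^ n)" using p by (simp add: powr_realpow)
  have "2\<^sup>2 * (real k - 1) \<le> (real k - 1)\<^sup>2 * (real k - 1)"
    using k by (intro mult_right_mono power_mono) auto
  also have "\<dots> = (real k - 1) ^ 3" by (simp add: power2_eq_square power3_eq_cube)
  also note A
  finally have "2\<^sup>2 * (real k - 1) < real (p ^ n)" .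
  moreover have "real k \<le> 2\<^sup>2 * (real k - 1)" using k by simp
  ultimately have "real k < real (p ^ n)" by (rule le_less_trans[rotated])
  then have "k < p ^ n" by (simp only: of_nat_less_iff)
  also have "\<dots> \<le> a * p ^ n" using assms(2) by simp
  finally show ?thesis .
qed

end

(* Write E k m for s(m, m - k). For fixed k, E k is an integer combination of the binomials C(m, j)
   with 1 <= j <= 2k, and C(p m, j) = p C(m, j) modulo p^(n + 1) when p^n divides m and j is small
   compared with p^(n / 2). So v(E k (p m)) = v(E k m) + 1 as soon as v(E k m) < n. For odd k, the
   reflection X -> - X - m of (X + 1) ... (X + m - 1) gives
   2 E k m = m (m - k) E (k - 1) m modulo m^3 up to powers of 2, whence
   v(E k m) = n + v(k) + v(E (k - 1) m) for m = a p^n. Raising n by one therefore adds 1 + 1. *)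

theory Submission
  imports Defs "HOL-Computational_Algebra.Polynomial"
begin

section \<open>Valuations of cofactors and of congruent elements\<close>

lemma multiplicity_int: "multiplicity (int p) (int x) = multiplicity p x"
  by (simp add: multiplicity_def flip: of_nat_power)

text \<open>Cancelling \<open>x\<close> costs as many powers of \<open>p\<close> as \<open>x\<close>
  contains, hence at most \<open>l\<close>.\<close>

lemma prime_power_dvd_cofactor:
  fixes p x y :: "'a :: factorial_semiring"
  assumes "prime_elem p" "x \<noteq> 0" "multiplicity p x \<le> l" "p ^ n dvd x * y"
  shows "p ^ (n - l) dvd y"
proof (cases "y = 0")
  case False
  have "n \<le> multiplicity p (x * y)"
    using assms False by (intro multiplicity_geI) auto
  then show ?thesis
    using assms False by (intro multiplicity_dvd') (simp add: prime_elem_multiplicity_mult_distrib)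
qed auto

text \<open>Up to exponent \<open>n\<close> the same powers of \<open>p\<close> divide
  \<open>x\<close> and \<open>y\<close>, and the first power that fails to divide \<open>y\<close>
  lies in this range.\<close>

lemma multiplicity_eq_of_dvd_diff:
  fixes p x y :: "'a :: {factorial_semiring, comm_ring_1}"
  assumes "\<not> is_unit p" "y \<noteq> 0" "multiplicity p y < n" "p ^ n dvd x - y"
  shows "multiplicity p x = multiplicity p y"
proof (rule multiplicity_eqI)
  have "p ^ i dvd x \<longleftrightarrow> p ^ i dvd y" if "i \<le> n" for i
    using dvd_add_right_iff[of "p ^ i" "x - y" y] dvd_trans[OF le_imp_power_dvd[OF that] assms(4)]
    by simp
  then show "p ^ multiplicity p y dvd x" "\<not> p ^ Suc (multiplicity p y) dvd x"
    using assms multiplicity_dvd[of p y]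
    by (simp_all add: Suc_le_eq power_dvd_iff_le_multiplicity del: power_Suc)
qed

section \<open>Stirling numbers at fixed distance from the diagonal\<close>

text \<open>Beyond the diagonal the value is set to \<open>0\<close>, since there \<open>m - k\<close> truncates; with this
  convention the recurrence holds for all \<open>m\<close>.\<close>

definition stirling_codiag :: "nat \<Rightarrow> nat \<Rightarrow> nat" where
  "stirling_codiag k m = (if k \<le> m then stirling m (m - k) else 0)"

lemma stirling_codiag_0 [simp]: "stirling_codiag 0 m = 1"
  by (simp add: stirling_codiag_def)

lemma stirling_codiag_Suc_0 [simp]: "stirling_codiag (Suc k) 0 = 0"
  by (simp add: stirling_codiag_def)

lemma stirling_codiag_Suc_Suc:
  "stirling_codiag (Suc k) (Suc m) = stirling_codiag (Suc k) m + m * stirling_codiag k m"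
proof (cases "k < m")
  case True
  then obtain d where "m = Suc (k + d)" by (metis less_imp_Suc_add)
  then show ?thesis by (simp add: stirling_codiag_def Suc_diff_le)
next
  case False
  then show ?thesis by (cases "k = m"; cases m) (auto simp: stirling_codiag_def)
qed

text \<open>The forward difference of \<open>stirling_codiag (Suc k)\<close> is
  \<open>m * stirling_codiag k m\<close>, so its Newton expansion arises from that of
  \<open>stirling_codiag k\<close> by multiplying by \<open>m\<close> and summing. Each operation
  raises the degree by one, whence the bound \<open>2 * k\<close>.\<close>

lemma stirling_codiag_newton:
  "\<exists>b. (\<forall>j>2 * k. b j = 0) \<and> (\<forall>m. stirling_codiag k m = (\<Sum>j\<le>2 * k. b j * (m choose j)))"
proof (induction k)
  case 0
  show ?case by (rule exI[of _ "\<lambda>j. if j = 0 then 1 else 0"]) simp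
next
  case (Suc k)
  then obtain b where b0: "\<forall>j>2 * k. b j = 0"
    and b: "\<And>m. stirling_codiag k m = (\<Sum>j\<le>2 * k. b j * (m choose j))" by blast
  \<comment> \<open>\<open>c i\<close> is the coefficient of \<open>m choose Suc i\<close> in
    \<open>m * stirling_codiag k m\<close>: by \<open>absorb\<close> below, \<open>b i\<close> and
    \<open>b (Suc i)\<close> both feed into it with weight \<open>Suc i\<close>.\<close>
  define c where "c i = (b i + b (Suc i)) * Suc i" for i
  \<comment> \<open>Summing over the argument turns \<open>m choose Suc i\<close> into
    \<open>m choose Suc (Suc i)\<close>.\<close>
  define b' where "b' j = (if j < 2 then 0 else c (j - 2))" for j
  have b': "(\<Sum>j\<le>2 * Suc k. b' j * (m choose j)) = (\<Sum>i\<le>2 * k. c i * (m choose Suc (Suc i)))" for m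
    by (simp add: sum.atMost_Suc_shift b'_def del: sum.atMost_Suc binomial_Suc_Suc)
  have absorb: "m * (m choose j) = Suc j * (m choose Suc j) + j * (m choose j)" for m j
  proof (cases "j \<le> m")
    case True
    then show ?thesis
      using binomial_absorb_comp[of m j] binomial_absorption[of j m]
      by (metis add_mult_distrib le_add_diff_inverse2)
  qed (simp add: binomial_eq_0)
  have step: "m * stirling_codiag k m = (\<Sum>i\<le>2 * k. c i * (m choose Suc i))" for m
  proof -
    have "m * stirling_codiag k m = (\<Sum>j\<le>2 * k. b j * (m * (m choose j)))"
      by (simp add: b sum_distrib_left ac_simps)
    also have "\<dots> = (\<Sum>j\<le>2 * k. b j * Suc j * (m choose Suc j)) + (\<Sum>j\<le>2 * k. b j * j * (m choose j))"
      unfolding absorb by (simp only: sum.distrib distrib_left mult.assoc)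
    \<comment> \<open>The added term is zero because \<open>b\<close> vanishes beyond
      \<open>2 * k\<close>. The shift that follows drops \<open>j = 0\<close>, which its factor
      \<open>j\<close> kills.\<close>
    also have "(\<Sum>j\<le>2 * k. b j * j * (m choose j)) = (\<Sum>j\<le>Suc (2 * k). b j * j * (m choose j))"
      using b0 by simp
    also have "\<dots> = (\<Sum>j\<le>2 * k. b (Suc j) * Suc j * (m choose Suc j))"
      by (subst sum.atMost_Suc_shift) simp
    finally show ?thesis
      by (simp add: c_def sum.distrib algebra_simps)
  qed
  have "stirling_codiag (Suc k) m = (\<Sum>i\<le>2 * k. c i * (m choose Suc (Suc i)))" for m
  proof (induction m)
    case (Suc m)
    then show ?case
      unfolding stirling_codiag_Suc_Suc step
      by (simp add: sum.distrib distrib_left)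
  qed simp
  moreover have "\<forall>j>2 * Suc k. b' j = 0"
    using b0 by (simp add: b'_def c_def)
  ultimately show ?case using b' by auto
qed

section \<open>Even index: passing from \<open>m\<close> to \<open>p * m\<close>\<close>

text \<open>By Pascal's rule, \<open>(m - 1) choose i\<close> and
  \<open>(m - 1) choose Suc i\<close> add up to \<open>m choose Suc i\<close>, which is divisible by
  \<open>p ^ (n - l)\<close> by absorption. So modulo that power the values alternate in sign,
  starting from 1.\<close>

lemma binomial_pred_cong:
  fixes p m :: nat
  assumes p: "prime p" and m: "0 < m" "p ^ n dvd m"
    and v: "\<And>i. i \<in> {1..d} \<Longrightarrow> multiplicity p i \<le> l"
    and "i \<le> d"
  shows "int p ^ (n - l) dvd int ((m - 1) choose i) - (-1) ^ i"
  using \<open>i \<le> d\<close>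
proof (induction i)
  case (Suc i)
  have "p ^ n dvd Suc i * (m choose Suc i)"
    using m(2) by (simp only: binomial_absorption dvd_mult2)
  then have "p ^ (n - l) dvd (m choose Suc i)"
    using p v[of "Suc i"] Suc.prems by (intro prime_power_dvd_cofactor[of p "Suc i"]) auto
  then have "int p ^ (n - l) dvd int (m choose Suc i)"
    by (metis int_dvd_int_iff of_nat_power)
  moreover have "int (m choose Suc i) = int ((m - 1) choose i) + int ((m - 1) choose Suc i)"
    using m(1) by (cases m) simp_all
  moreover have "int p ^ (n - l) dvd int ((m - 1) choose i) - (-1) ^ i"
    using Suc by simp
  ultimately have "int p ^ (n - l) dvd
      (int ((m - 1) choose i) + int ((m - 1) choose Suc i)) - (int ((m - 1) choose i) - (-1) ^ i)"
    by (metis dvd_diff)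
  then show ?case by simp
qed simp

text \<open>Absorption turns \<open>j\<close> times the difference into \<open>p * m\<close> times a
  difference of binomials that are both congruent to \<open>(-1) ^ (j - 1)\<close> modulo
  \<open>p ^ (n - l)\<close>. This surplus pays for cancelling \<open>j\<close>, which costs at most
  \<open>l\<close>, because \<open>2 * l <= n\<close>.\<close>

lemma binomial_prime_mult_cong:
  fixes p m :: nat
  assumes p: "prime p" and m: "0 < m" "p ^ n dvd m"
    and v: "\<And>i. i \<in> {1..d} \<Longrightarrow> multiplicity p i \<le> l"
    and l: "2 * l \<le> n" and j: "1 \<le> j" "j \<le> d"
  shows "int p ^ (n + 1) dvd int (p * m choose j) - int p * int (m choose j)"
proof -
  have p0: "0 < p" using p by (rule prime_gt_0_nat)
  let ?A = "int ((p * m - 1) choose (j - 1))" and ?B = "int ((m - 1) choose (j - 1))"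
  have "int p ^ (n - l) dvd ?A - (-1) ^ (j - 1)"
    using assms p0 by (intro binomial_pred_cong[where d = d]) auto
  moreover have "int p ^ (n - l) dvd ?B - (-1) ^ (j - 1)"
    using assms by (intro binomial_pred_cong[where d = d]) auto
  ultimately have "int p ^ (n - l) dvd (?A - (-1) ^ (j - 1)) - (?B - (-1) ^ (j - 1))"
    by (rule dvd_diff)
  then have "int p ^ (n - l) dvd ?A - ?B" by simp
  moreover have "int p ^ (n + 1) dvd int p * int m"
  proof -
    have "int (p ^ (n + 1)) dvd int (p * m)"
      unfolding int_dvd_int_iff using m(2) by (simp add: mult_dvd_mono)
    then show ?thesis by simp
  qed
  ultimately have "int p ^ (n + 1) * int p ^ (n - l) dvd int p * int m * (?A - ?B)"
    by (rule mult_dvd_mono[rotated])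
  moreover have "int j * (int (p * m choose j) - int p * int (m choose j)) = int p * int m * (?A - ?B)"
  proof -
    have A: "int j * int (p * m choose j) = int p * int m * ?A"
      using times_binomial_minus1_eq[of j "p * m"] j(1) by (simp flip: of_nat_mult)
    have B: "int j * int (m choose j) = int m * ?B"
      using times_binomial_minus1_eq[of j m] j(1) by (simp flip: of_nat_mult)
    have "int j * (int (p * m choose j) - int p * int (m choose j))
        = int j * int (p * m choose j) - int p * (int j * int (m choose j))"
      by (simp only: right_diff_distrib mult.left_commute)
    then show ?thesis
      by (simp only: A B right_diff_distrib mult.assoc)
  qed
  ultimately have "int p ^ (n + 1 + (n - l)) dvd
      int j * (int (p * m choose j) - int p * int (m choose j))"
    by (simp only: power_add)
  then have "int p ^ (n + 1 + (n - l) - l) dvd int (p * m choose j) - int p * int (m choose j)"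
    using p v[of j] j
    by (intro prime_power_dvd_cofactor[of "int p" "int j"]) (auto simp: multiplicity_int)
  then show ?thesis
    by (rule power_le_dvd) (use l in simp)
qed

text \<open>The binomial congruence carries over termwise to the Newton expansion. It holds modulo
  \<open>p ^ (n + 1)\<close>, while \<open>p * stirling_codiag k m\<close> has valuation at most
  \<open>n\<close>.\<close>

lemma multiplicity_stirling_codiag_prime_mult:
  fixes p m :: nat
  assumes p: "prime p" and k: "1 \<le> k" "k < m" and m: "p ^ n dvd m"
    and v: "\<And>i. i \<in> {1..2 * k} \<Longrightarrow> multiplicity p i \<le> l"
    and l: "2 * l \<le> n"
    and small: "multiplicity p (stirling_codiag k m) < n"
  shows "multiplicity p (stirling_codiag k (p * m)) = multiplicity p (stirling_codiag k m) + 1"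
proof -
  obtain b where b: "\<And>m. stirling_codiag k m = (\<Sum>j\<le>2 * k. b j * (m choose j))"
    using stirling_codiag_newton by blast
  \<comment> \<open>The constant term has to vanish: at \<open>j = 0\<close> both binomials are 1
    and the congruence fails.\<close>
  have "b 0 = stirling_codiag k 0"
    by (simp add: b sum.atMost_shift)
  then have "b 0 = 0" using k by (simp add: stirling_codiag_def)
  then have b: "stirling_codiag k m = (\<Sum>j=1..2 * k. b j * (m choose j))" for m
    by (simp add: b atMost_atLeast0 sum.atLeast_Suc_atMost)
  have pos: "0 < stirling_codiag k m"
    using k stirling_diff_pos[of k m] by (simp add: stirling_codiag_def)
  have "int (stirling_codiag k (p * m)) - int p * int (stirling_codiag k m)
      = (\<Sum>j=1..2 * k. int (b j) * (int (p * m choose j) - int p * int (m choose j)))"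
    by (simp add: b sum_distrib_left sum_subtractf algebra_simps)
  moreover have "int p ^ (n + 1) dvd \<dots>"
    using assms by (intro dvd_sum dvd_mult binomial_prime_mult_cong[where d = "2 * k" and l = l]) auto
  ultimately have dvd: "int p ^ (n + 1) dvd
      int (stirling_codiag k (p * m)) - int (p * stirling_codiag k m)"
    by simp
  have mult: "multiplicity p (p * stirling_codiag k m) = Suc (multiplicity p (stirling_codiag k m))"
    using p pos by (intro multiplicity_times_same) (auto dest: prime_gt_1_nat)
  have "multiplicity (int p) (int (stirling_codiag k (p * m)))
      = multiplicity (int p) (int (p * stirling_codiag k m))"
  proof (rule multiplicity_eq_of_dvd_diff[OF _ _ _ dvd])
    show "\<not> is_unit (int p)" using prime_gt_1_nat[OF p] by simp
    show "int (p * stirling_codiag k m) \<noteq> 0" using pos prime_gt_0_nat[OF p] by simp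
    show "multiplicity (int p) (int (p * stirling_codiag k m)) < n + 1"
      unfolding multiplicity_int mult using small by simp
  qed
  then show ?thesis
    by (simp only: multiplicity_int mult)
qed

section \<open>Odd index: reflection\<close>

text \<open>One factor \<open>x\<close> is cancelled from \<open>pochhammer x (Suc n)\<close>. The
  lemma covers any domain so that polynomials can be put for \<open>x\<close>.\<close>

lemma pochhammer_plus_1_stirling:
  fixes x :: "'a :: idom"
  assumes "x \<noteq> 0"
  shows "pochhammer (x + 1) n = (\<Sum>r\<le>n. of_nat (stirling (Suc n) (Suc r)) * x ^ r)"
proof -
  have "x * pochhammer (x + 1) n = (\<Sum>r\<le>Suc n. of_nat (stirling (Suc n) r) * x ^ r)"
    by (simp only: stirling_pochhammer pochhammer_rec)
  also have "\<dots> = x * (\<Sum>r\<le>n. of_nat (stirling (Suc n) (Suc r)) * x ^ r)"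
    by (subst sum.atMost_Suc_shift) (simp add: sum_distrib_left ac_simps del: stirling.simps(4))
  finally show ?thesis using assms by simp
qed

text \<open>Compare the coefficients of \<open>X ^ d\<close> in \<open>(X + 1) \<cdots> (X + n)\<close> and in its image under
  \<open>X \<mapsto> - X - (n + 1)\<close>, which permutes the linear factors up to sign.\<close>

lemma stirling_reflection:
  assumes "d \<le> n"
  shows "(-1) ^ n * int (stirling (Suc n) (Suc d))
    = (\<Sum>r=d..n. (-1) ^ r * int (r choose d) * int (Suc n) ^ (r - d) * int (stirling (Suc n) (Suc r)))"
proof -
  define X :: "int poly" where "X = [:0, 1:]"
  define Y :: "int poly" where "Y = [:int (Suc n), 1:]"
  have Y: "Y = X + of_nat (Suc n)" by (simp add: X_def Y_def of_nat_poly)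
  have ne: "X \<noteq> 0" "- Y \<noteq> 0" by (simp_all add: X_def Y_def)
  have "- Y + 1 = - (X + of_nat n)" by (simp add: Y)
  then have "pochhammer (- Y + 1) n = pochhammer (- (X + of_nat n)) n" by (rule arg_cong)
  \<comment> \<open>The factors \<open>- (X + n), ..., - (X + 1)\<close> are read backwards.\<close>
  also have "\<dots> = (-1) ^ n * pochhammer (X + 1) n"
    by (subst pochhammer_minus) simp
  finally have "(\<Sum>r\<le>n. of_nat (stirling (Suc n) (Suc r)) * (- Y) ^ r)
      = (-1) ^ n * (\<Sum>r\<le>n. of_nat (stirling (Suc n) (Suc r)) * X ^ r)"
    by (simp only: ne[THEN pochhammer_plus_1_stirling])
  then have eq: "coeff (\<Sum>r\<le>n. of_nat (stirling (Suc n) (Suc r)) * (- Y) ^ r) d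
      = coeff ((-1) ^ n * (\<Sum>r\<le>n. of_nat (stirling (Suc n) (Suc r)) * X ^ r)) d"
    by (rule arg_cong)
  have cY: "coeff (of_nat c * (- Y) ^ r) d
      = (if d \<le> r then (-1) ^ r * int (r choose d) * int (Suc n) ^ (r - d) * int c else 0)" for c r
  proof -
    have "of_nat c * (- Y) ^ r = smult (int c * (-1) ^ r) (Y ^ r)"
      by (subst power_minus) (simp add: of_nat_poly poly_eq_iff minus_one_power_iff)
    moreover have "coeff (Y ^ r) d = 0" if "r < d"
    proof (rule coeff_eq_0)
      have "degree (Y ^ r) \<le> degree Y * r" by (rule degree_power_le)
      then show "degree (Y ^ r) < d" using that by (simp add: Y_def)
    qed
    moreover have "coeff (Y ^ r) d = int (r choose d) * int (Suc n) ^ (r - d)" if "d \<le> r"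
      unfolding Y_def by (subst coeff_linear_poly_power[OF that]) simp
    ultimately show ?thesis by simp
  qed
  have cX: "coeff (of_nat c * X ^ r) d = (if r = d then int c else 0)" for c r
    by (auto simp: X_def of_nat_poly simp flip: monom_altdef)
  have "coeff ((-1) ^ n * (\<Sum>r\<le>n. of_nat (stirling (Suc n) (Suc r)) * X ^ r)) d
      = (-1) ^ n * coeff (\<Sum>r\<le>n. of_nat (stirling (Suc n) (Suc r)) * X ^ r) d"
    by (simp add: minus_one_power_iff)
  also have "\<dots> = (-1) ^ n * int (stirling (Suc n) (Suc d))"
    using assms by (simp add: coeff_sum cX del: stirling.simps(4))
  finally have "(-1) ^ n * int (stirling (Suc n) (Suc d))
      = (\<Sum>r\<le>n. if d \<le> r then (-1) ^ r * int (r choose d) * int (Suc n) ^ (r - d)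
          * int (stirling (Suc n) (Suc r)) else 0)"
    using eq by (simp only: coeff_sum cY)
  also have "\<dots> = (\<Sum>r=d..n. (-1) ^ r * int (r choose d) * int (Suc n) ^ (r - d)
          * int (stirling (Suc n) (Suc r)))"
    by (rule sum.mono_neutral_cong_right) auto
  finally show ?thesis .
qed

text \<open>In the reflection at \<open>d = j - 1\<close>, parity gives the left side and the term
  \<open>r = d\<close> opposite signs, so they combine to \<open>2 * stirling m j\<close>. The terms
  from \<open>r = d + 3\<close> on contain \<open>m ^ 3\<close>.\<close>

lemma stirling_odd_expansion:
  assumes "1 \<le> j" "odd (m - j)"
  obtains t where "2 * int (stirling m j) = int j * int m * int (stirling m (j + 1))
    - int (Suc j choose 2) * int m ^ 2 * int (stirling m (j + 2)) + int m ^ 3 * t"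
proof -
  obtain d where d: "j = Suc d" using assms(1) by (cases j) auto
  have "j < m" using assms(2) by (metis odd_pos zero_less_diff)
  then obtain e where "m = j + Suc e" by (metis less_imp_Suc_add add_Suc_right)
  then have m: "m = Suc (Suc (d + e))" and e: "even e" using assms(2) d by auto
  define h where "h = (\<lambda>r. (-1) ^ r * int (r choose d) * int m ^ (r - d) * int (stirling m (Suc r)))"
  have "(-1) ^ Suc (d + e) * int (stirling m (Suc d)) = sum h {d..Suc (d + e)}"
    unfolding m h_def by (rule stirling_reflection) simp
  also have "\<dots> = h d + h (Suc d) + sum h {Suc (Suc d)..Suc (d + e)}"
    by (simp add: sum.atLeast_Suc_atMost)
  \<comment> \<open>For \<open>e = 0\<close> the range on the left is empty, and the split survives
    because \<open>h (Suc (Suc d))\<close> contains \<open>stirling m (m + 1) = 0\<close>.\<close>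
  also have "sum h {Suc (Suc d)..Suc (d + e)} = h (Suc (Suc d)) + sum h {d + 3..Suc (d + e)}"
  proof (cases "e = 0")
    case True
    then show ?thesis by (simp add: h_def m del: stirling.simps(4))
  next
    case False
    then show ?thesis
      using sum.atLeast_Suc_atMost[of "Suc (Suc d)" "Suc (d + e)" h] by (simp add: numeral_3_eq_3)
  qed
  finally have "(-1) ^ Suc (d + e) * int (stirling m (Suc d))
      = h d + h (Suc d) + h (Suc (Suc d)) + sum h {d + 3..Suc (d + e)}" by simp
  moreover have "int m ^ 3 dvd sum h {d + 3..Suc (d + e)}"
    by (rule dvd_sum) (auto simp: h_def intro!: dvd_mult2[OF dvd_mult[OF le_imp_power_dvd]])
  then obtain s where "sum h {d + 3..Suc (d + e)} = int m ^ 3 * s" by (elim dvdE)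
  moreover have "h d = (-1) ^ d * int (stirling m (Suc d))"
    "h (Suc d) = - ((-1) ^ d * int (Suc d) * int m * int (stirling m (Suc (Suc d))))"
    by (simp_all add: h_def)
  moreover have "Suc (Suc d) choose d = Suc (Suc d) choose 2"
    using binomial_symmetric[of 2 "Suc (Suc d)"] by simp
  then have "h (Suc (Suc d))
      = (-1) ^ d * int (Suc (Suc d) choose 2) * int m ^ 2 * int (stirling m (Suc (Suc (Suc d))))"
    by (simp only: h_def) simp
  moreover have "(-1 :: int) ^ Suc (d + e) = - ((-1) ^ d)"
    using e by (simp add: power_add)
  ultimately have eq: "- ((-1) ^ d) * int (stirling m (Suc d)) = (-1) ^ d * int (stirling m (Suc d))
      - (-1) ^ d * int (Suc d) * int m * int (stirling m (Suc (Suc d)))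
      + (-1) ^ d * int (Suc (Suc d) choose 2) * int m ^ 2 * int (stirling m (Suc (Suc (Suc d))))
      + int m ^ 3 * s" by simp
  show thesis
  proof (rule that)
    show "2 * int (stirling m j) = int j * int m * int (stirling m (j + 1))
      - int (Suc j choose 2) * int m ^ 2 * int (stirling m (j + 2)) + int m ^ 3 * (- ((-1) ^ d) * s)"
      using eq unfolding d
      by (cases "even d") (simp_all add: algebra_simps del: binomial_Suc_Suc stirling.simps(4))
  qed
qed

lemma stirling_odd_dvd:
  assumes "1 \<le> j" "odd (m - j)"
  shows "int m dvd 2 * int (stirling m j)"
proof -
  obtain t where t: "2 * int (stirling m j) = int j * int m * int (stirling m (j + 1))
    - int (Suc j choose 2) * int m ^ 2 * int (stirling m (j + 2)) + int m ^ 3 * t"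
    using stirling_odd_expansion[OF assms] .
  show ?thesis unfolding t
    by (simp add: power2_eq_square power3_eq_cube)
qed

text \<open>The \<open>m\<^sup>2\<close>-term of the expansion again has a Stirling number of odd index as a factor, so it
  contributes a third factor \<open>m\<close>.\<close>

lemma stirling_odd_cong:
  assumes "1 \<le> j" "odd (m - j)"
  shows "int m ^ 3 dvd 4 * int (stirling m j) - 2 * int j * int m * int (stirling m (j + 1))"
proof -
  obtain t where t: "2 * int (stirling m j) = int j * int m * int (stirling m (j + 1))
    - int (Suc j choose 2) * int m ^ 2 * int (stirling m (j + 2)) + int m ^ 3 * t"
    using stirling_odd_expansion[OF assms] .
  have "int m dvd 2 * int (stirling m (j + 2))"
  proof (cases "j + 2 \<le> m")
    case True
    then have "odd (m - (j + 2))" using assms(2) by simp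
    then show ?thesis by (intro stirling_odd_dvd) auto
  qed simp
  then obtain u where u: "2 * int (stirling m (j + 2)) = int m * u" by (elim dvdE)
  \<comment> \<open>Doubling the expansion supplies the 2 that \<open>stirling_odd_dvd\<close>
    requires next to \<open>stirling m (j + 2)\<close>.\<close>
  have "4 * int (stirling m j) - 2 * int j * int m * int (stirling m (j + 1))
      = int m ^ 3 * (2 * t) - int (Suc j choose 2) * int m ^ 2 * (2 * int (stirling m (j + 2)))"
    using t by (simp add: algebra_simps del: binomial_Suc_Suc)
  also have "\<dots> = int m ^ 3 * (2 * t - int (Suc j choose 2) * u)"
    unfolding u by (simp add: algebra_simps power2_eq_square power3_eq_cube)
  finally show ?thesis by simp
qed

text \<open>As \<open>p\<close> is odd, the factors 4 and 2 in \<open>stirling_odd_cong\<close>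
  leave valuations unchanged. The term with \<open>stirling m (j + 1)\<close> has valuation below
  \<open>3 * n\<close>, so the congruence modulo \<open>m ^ 3\<close> passes it on to
  \<open>stirling m j\<close>.\<close>

lemma multiplicity_stirling_odd:
  fixes p m k :: nat
  assumes p: "prime p" "odd p" and k: "odd k" "k < p ^ n" "k < m"
    and m: "multiplicity p m = n"
    and small: "multiplicity p (stirling m (m - (k - 1))) < n"
  shows "multiplicity p (stirling m (m - k))
    = n + multiplicity p k + multiplicity p (stirling m (m - (k - 1)))"
proof -
  have pe: "prime_elem p" using p by simp
  have k0: "0 < k" using k(1) by (rule odd_pos)
  have not_dvd2: "\<not> p dvd 2" using p by (metis dvd_refl prime_nat_iff two_is_prime_nat primes_dvd_imp_eq)
  have v2: "multiplicity p 2 = 0" using not_dvd2 by (rule not_dvd_imp_multiplicity_0)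
  have "multiplicity p (2 ^ 2) = 2 * multiplicity p 2"
    by (rule prime_elem_multiplicity_power_distrib) (use pe in auto)
  then have v4: "multiplicity p 4 = 0" using v2 by simp
  define j where "j = m - k"
  have j: "1 \<le> j" "odd (m - j)" "m - (k - 1) = j + 1" "m = j + k"
    using k k0 by (auto simp: j_def)
  have pk: "multiplicity p k < n"
  proof (rule multiplicity_lessI)
    show "\<not> p ^ n dvd k" using k k0 by (metis dvd_imp_le not_le)
    show "k \<noteq> 0" using k0 by simp
    show "\<not> is_unit p" using prime_gt_1_nat[OF p(1)] by simp
  qed
  have dm: "int p ^ n dvd int m"
    using multiplicity_dvd[of p m] m by (metis int_dvd_int_iff of_nat_power)
  \<comment> \<open>\<open>j = m - k\<close> is congruent to \<open>- k\<close> modulo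
    \<open>p ^ n\<close>, and \<open>k < p ^ n\<close> keeps the valuation of \<open>k\<close> below
    \<open>n\<close>.\<close>
  have vj: "multiplicity p j = multiplicity p k"
  proof -
    have "multiplicity (int p) (- int j) = multiplicity (int p) (int k)"
    proof (rule multiplicity_eq_of_dvd_diff)
      show "int p ^ n dvd - int j - int k"
        using dm by (subst dvd_minus_iff[symmetric]) (simp add: j(4) add.commute)
      show "\<not> is_unit (int p)" using prime_gt_1_nat[OF p(1)] by simp
      show "int k \<noteq> 0" using k0 by simp
      show "multiplicity (int p) (int k) < n" using pk by (simp only: multiplicity_int)
    qed
    moreover have "multiplicity (int p) (- int j) = multiplicity (int p) (int j)"
      using multiplicity_times_unit_right[of "-1" "int p" "int j"] by simp
    ultimately show ?thesis by (simp only: multiplicity_int)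
  qed
  have "0 < stirling m (m - (k - 1))" using k(3) by (intro stirling_diff_pos) simp
  then have pos: "0 < stirling m (j + 1)" "0 < stirling m j"
    using stirling_diff_pos[OF k(3)] by (simp_all only: j(3) j_def)
  have ne: "2 * j * m * stirling m (j + 1) \<noteq> 0" using pos(1) j(1) k(3) by simp
  have val: "multiplicity p (2 * j * m * stirling m (j + 1))
      = multiplicity p k + n + multiplicity p (stirling m (j + 1))"
    using ne by (simp add: prime_elem_multiplicity_mult_distrib[OF pe] v2 vj m)
  have "int p ^ (n * 3) dvd int m ^ 3"
    using dm by (simp only: power_mult dvd_power_same)
  then have dvd: "int p ^ (n * 3) dvd
      int (4 * stirling m j) - int (2 * j * m * stirling m (j + 1))"
    using stirling_odd_cong[OF j(1,2)] by (auto intro: dvd_trans)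
  have "multiplicity (int p) (int (4 * stirling m j))
      = multiplicity (int p) (int (2 * j * m * stirling m (j + 1)))"
  proof (rule multiplicity_eq_of_dvd_diff[OF _ _ _ dvd])
    show "multiplicity (int p) (int (2 * j * m * stirling m (j + 1))) < n * 3"
      unfolding multiplicity_int val using small[unfolded j(3)] pk by linarith
  qed (use p ne in \<open>auto simp del: of_nat_mult\<close>)
  then have "multiplicity p (4 * stirling m j)
      = multiplicity p k + n + multiplicity p (stirling m (j + 1))"
    by (simp only: multiplicity_int val)
  moreover have "multiplicity p (4 * stirling m j) = multiplicity p (stirling m j)"
    using pos by (simp add: prime_elem_multiplicity_mult_distrib[OF pe] v4)
  ultimately show ?thesis unfolding j(3) by (simp add: j_def)
qed

section \<open>Consequences of the bound on the exponent\<close>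

lemma power_bound_of_log_bound:
  assumes "prime p" "0 < a" "3 \<le> k"
    and "real n > 3 * log (real p) (real k - 1) + log (real p) (real a)"
  shows "a * (k - 1) ^ 3 < p ^ n"
proof -
  have p: "1 < real p" using prime_gt_1_nat[OF assms(1)] by simp
  define r where "r = k - 1"
  have r: "real k - 1 = real r" "0 < r" using assms(3) by (auto simp: r_def)
  have "log (real p) (real (a * r ^ 3)) = log (real p) (real a) + 3 * log (real p) (real r)"
    using p r(2) assms(2) by (simp add: log_mult log_nat_power)
  also have "\<dots> < real n" using assms(4) unfolding r(1) by simp
  finally have "real (a * r ^ 3) < real p powr real n"
    using p r(2) assms(2) by (subst (asm) log_less_iff) auto
  then have "real (a * r ^ 3) < real (p ^ n)" using p by (simp add: powr_realpow)
  then show ?thesis by (simp only: of_nat_less_iff r_def)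
qed

text \<open>This yields \<open>2 * l <= n\<close> for the even index. If \<open>p ^ e\<close>
  divides \<open>i\<close> and \<open>k >= 4\<close>, then
  \<open>p ^ (2 * e) <= (2 * k) ^ 2 <= k ^ 3 < p ^ n\<close>.\<close>

lemma multiplicity_le_half:
  fixes p i k n :: nat
  assumes "prime p" "p \<ge> 5" "2 \<le> k" "even k" "k ^ 3 < p ^ n" "i \<in> {1..2 * k}"
  shows "2 * multiplicity p i \<le> n"
\<comment> \<open>\<open>4 * k ^ 2 <= k ^ 3\<close> needs \<open>k >= 4\<close>; in the remaining
  case \<open>k = 2\<close> one has \<open>i <= 4 < p\<close>.\<close>
proof (cases "k = 2")
  case True
  then have "\<not> p dvd i" using assms by (auto dest!: dvd_imp_le)
  then show ?thesis by (simp add: not_dvd_imp_multiplicity_0)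
next
  case False
  then have k: "4 \<le> k" using assms(3,4) by presburger
  have "p ^ multiplicity p i \<le> i" using assms(6) by (intro dvd_imp_le multiplicity_dvd) auto
  then have "p ^ multiplicity p i \<le> 2 * k" using assms(6) by simp
  then have "(p ^ multiplicity p i) ^ 2 \<le> (2 * k) ^ 2" by (rule power_mono) simp
  also have "\<dots> = 4 * k ^ 2" by (simp add: power2_eq_square)
  also have "\<dots> \<le> k * k ^ 2" using k by simp
  also have "\<dots> < p ^ n" using assms(5) by (simp add: power2_eq_square power3_eq_cube)
  finally have "p ^ (2 * multiplicity p i) < p ^ n" by (simp add: mult.commute flip: power_mult)
  then show ?thesis using assms(2) by (simp add: power_less_imp_less_exp less_imp_le)
qed

section \<open>Combining the even and the odd index along the exponents
  \<open>n >= n1\<close>\<close>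

theorem theorem1p5:
  fixes p a k n1 :: nat
  assumes "prime p" and "p \<ge> 5"
    and "a > 0" and "gcd a p = 1"
    and "k \<ge> 3" and "odd k"
    and "n1 > 0"
    and "real n1 > 3 * log (real p) (real k - 1) + log (real p) (real a)"
    and "multiplicity p (stirling (a * p ^ n1) (a * p ^ n1 - (k - 1))) < n1"
  shows "(\<forall>n\<ge>n1. multiplicity p (stirling (a * p ^ (n + 1)) (a * p ^ (n + 1) - k))
                  = multiplicity p (stirling (a * p ^ n) (a * p ^ n - k)) + 2)
       \<and> (\<forall>n\<ge>n1. multiplicity p (stirling (a * p ^ n) (a * p ^ n - k))
                  = multiplicity p (stirling (a * p ^ n1) (a * p ^ n1 - k)) + 2 * (n - n1))"
proof -
  have range: "k < a * p ^ n" if "n1 \<le> n" for n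
    using index_in_range[OF assms(1,3,5,8) that] .
  have bound: "(k - 1) ^ 3 < p ^ n" if "n1 \<le> n" for n
  proof -
    have "(k - 1) ^ 3 \<le> a * (k - 1) ^ 3" using assms(3) by simp
    also have "\<dots> < p ^ n1" using power_bound_of_log_bound assms by blast
    also have "\<dots> \<le> p ^ n" using that assms(2) by (intro power_increasing) auto
    finally show ?thesis .
  qed
  have k_less: "k < p ^ n" if "n1 \<le> n" for n
  proof -
    have "2 * 2 * (k - 1) \<le> (k - 1) * (k - 1) * (k - 1)"
      using assms(5) by (intro mult_mono) auto
    then have "4 * (k - 1) \<le> (k - 1) ^ 3" by (simp only: power3_eq_cube)
    also note bound[OF that]
    finally show ?thesis using assms(5) by linarith
  qed
  define v where "v n = multiplicity p (stirling (a * p ^ n) (a * p ^ n - (k - 1)))" for n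
  have even_step: "v (Suc n) = v n + 1" if "n1 \<le> n" "v n < n" for n
  proof -
    have codiag: "v i = multiplicity p (stirling_codiag (k - 1) (a * p ^ i))" if "n1 \<le> i" for i
      using range[OF that] by (simp add: v_def stirling_codiag_def)
    have "multiplicity p (stirling_codiag (k - 1) (p * (a * p ^ n)))
        = multiplicity p (stirling_codiag (k - 1) (a * p ^ n)) + 1"
    proof (rule multiplicity_stirling_codiag_prime_mult[where l = "n div 2" and n = n])
      show "multiplicity p i \<le> n div 2" if "i \<in> {1..2 * (k - 1)}" for i
      proof -
        have "2 * multiplicity p i \<le> n"
          using assms(5,6) that by (intro multiplicity_le_half[OF assms(1,2) _ _ bound[OF \<open>n1 \<le> n\<close>]]) auto
        then show ?thesis by linarith
      qed
      show "multiplicity p (stirling_codiag (k - 1) (a * p ^ n)) < n"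
        using that codiag by simp
    qed (use assms range[OF that(1)] in auto)
    then show ?thesis using codiag[of n] codiag[of "Suc n"] that by (simp add: ac_simps)
  qed
  \<comment> \<open>The hypothesis at \<open>n1\<close> propagates because \<open>v n\<close> and
    \<open>n\<close> grow by one together.\<close>
  have small: "v n < n" if "n1 \<le> n" for n
    using that
  proof (induction n rule: dec_induct)
    case base
    show ?case using assms(9) by (simp add: v_def)
  next
    case (step n)
    then show ?case using even_step[of n] by simp
  qed
  have odd_val: "multiplicity p (stirling (a * p ^ n) (a * p ^ n - k)) = n + multiplicity p k + v n"
    if "n1 \<le> n" for n
    unfolding v_def
  proof (rule multiplicity_stirling_odd)
    show "odd p" using prime_odd_nat[of p] assms(1,2) by simp
    have "\<not> p dvd a" using assms(1,4) by (metis dvd_refl gcd_greatest not_prime_unit)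
    then show "multiplicity p (a * p ^ n) = n"
      using assms(1) by (simp add: multiplicity_prime_elem_times_other)
  qed (use assms range[OF that] k_less[OF that] small[OF that] in \<open>auto simp: v_def\<close>)
  have main_step: "multiplicity p (stirling (a * p ^ (n + 1)) (a * p ^ (n + 1) - k))
      = multiplicity p (stirling (a * p ^ n) (a * p ^ n - k)) + 2" if "n1 \<le> n" for n
    using odd_val[of n] odd_val[of "n + 1"] even_step[OF that small[OF that]] that by simp
  moreover have "multiplicity p (stirling (a * p ^ n) (a * p ^ n - k))
      = multiplicity p (stirling (a * p ^ n1) (a * p ^ n1 - k)) + 2 * (n - n1)" if "n1 \<le> n" for n
    using that
  proof (induction n rule: dec_induct)
    case (step n)
    then show ?case using main_step[of n] by simp
  qed simp
  ultimately show ?thesis by blast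
qed

end
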